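(* Let $G=\{G_t,0\le t\le 1\}$ be a centered continuous Gaussian process on $[0,1]$, let $x_0\neq 0$, let $\Theta\subset\mathbb{R}$ and let $\theta_0\in\Theta$ be the true parameter. For $\varepsilon>0$ let $X=\{X_t,0\le t\le 1\}$ be the solution of $X_t=x_0+\theta_0\int_0^tX_s\,ds+\varepsilon G_t$, $0\le t\le 1$, with $X_0=x_0$, and let $\theta_\varepsilon^*$ be a minimum $L_1$-norm estimator of $\theta_0$ based on $X$. Let $$Y_t=e^{\theta_0t}\int_0^te^{-\theta_0s}\,dG_s,\quad 0\le t\le 1,\qquad \zeta=\arg\inf_{-\infty<u<\infty}\int_0^1|Y_t-u\,t\,x_0e^{\theta_0t}|\,dt.$$ Then, as $\varepsilon\to 0$, the random variable $\varepsilon^{-1}(\theta_\varepsilon^*-\theta_0)$ converges in probability to a random variable whose probability distribution is the same as that of $\zeta$ under $P_{\theta_0}$.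
   Context: All processes are defined on a stochastic basis $(\Omega,\mathcal{F},(\mathcal{F}_t),P)$ satisfying the usual conditions, and are adapted to $(\mathcal{F}_t)$. The initial value $x_0\in\mathbb{R}$ is fixed and nonrandom. The equation for $X$ is also written $dX_t=\theta X_t\,dt+\varepsilon\,dG_t$, $X_0=x_0$, with $\theta\in\Theta$ the unknown drift parameter. $P_{\theta_0}$ refers to probability when the true parameter is $\theta_0$. The function $x_t(\theta)=x_0e^{\theta t}$, $0\le t\le 1$, is the solution of the equation with $\varepsilon=0$. A minimum $L_1$-norm estimator $\theta_\varepsilon^*$ is a measurable selection with values in $\Theta$ satisfying $S_1(\theta_\varepsilon^* )=\inf_{\theta\in\Theta}S_1(\theta)$, where $S_1(\theta)=\int_0^1|X_t-x_t(\theta)|\,dt$. It is assumed that such a measurable selection exists. The integral $\int_0^te^{-\theta_0s}\,dG_s$ is interpreted pathwise as a Young integral. The process $Y$ is a zero mean Gaussian process and satisfies $X_t-x_t(\theta_0)=\varepsilon Y_t$.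
   Formalization: The true parameter θ_0 is assumed to be an interior point of Θ, not merely a point of Θ; otherwise the claim fails, e.g. for Θ={θ_0} the estimator error is identically 0, while ζ is nondegenerate when G is Brownian motion. *)

theory Defs
  imports "HOL-Probability.Probability"
begin

text \<open>Processes are families \<open>real \<Rightarrow> 'a \<Rightarrow> real\<close> (time first); only the times in \<open>{0..1}\<close> matter.\<close>

definition stochastic_basis :: "'a measure \<Rightarrow> (real \<Rightarrow> 'a measure) \<Rightarrow> bool" where
  "stochastic_basis M F \<longleftrightarrow>
     prob_space M \<and>
     (\<forall>t\<in>{0..1}. subalgebra M (F t)) \<and>
     (\<forall>s\<in>{0..1}. \<forall>t\<in>{0..1}. s \<le> t \<longrightarrow> sets (F s) \<subseteq> sets (F t))"

definition usual_conditions :: "'a measure \<Rightarrow> (real \<Rightarrow> 'a measure) \<Rightarrow> bool" where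
  "usual_conditions M F \<longleftrightarrow>
     complete_measure M \<and>
     null_sets M \<subseteq> sets (F 0) \<and>
     (\<forall>t\<in>{0..<1}. sets (F t) = (\<Inter>s\<in>{t<..1}. sets (F s)))"

definition adapted :: "(real \<Rightarrow> 'a measure) \<Rightarrow> (real \<Rightarrow> 'a \<Rightarrow> real) \<Rightarrow> bool" where
  "adapted F X \<longleftrightarrow> (\<forall>t\<in>{0..1}. X t \<in> borel_measurable (F t))"

text \<open>Almost surely constant variables count as (degenerate) Gaussian variables; they have to be
  listed separately because \<open>normal_density \<mu> 0\<close> is not a density.\<close>

definition gaussian_rv :: "'a measure \<Rightarrow> ('a \<Rightarrow> real) \<Rightarrow> bool" where
  "gaussian_rv M V \<longleftrightarrow>
     V \<in> borel_measurable M \<and>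
     (\<exists>\<mu>. (AE \<omega> in M. V \<omega> = \<mu>) \<or> (\<exists>\<sigma>>0. distributed M lborel V (normal_density \<mu> \<sigma>)))"

definition gaussian_process :: "'a measure \<Rightarrow> (real \<Rightarrow> 'a \<Rightarrow> real) \<Rightarrow> bool" where
  "gaussian_process M G \<longleftrightarrow>
     (\<forall>T a. finite T \<and> T \<subseteq> {0..1} \<longrightarrow> gaussian_rv M (\<lambda>\<omega>. \<Sum>t\<in>T. a t * G t \<omega>))"

definition centered_continuous_gaussian_process ::
    "'a measure \<Rightarrow> (real \<Rightarrow> 'a \<Rightarrow> real) \<Rightarrow> bool" where
  "centered_continuous_gaussian_process M G \<longleftrightarrow>
     gaussian_process M G \<and>
     (\<forall>t\<in>{0..1}. prob_space.expectation M (G t) = 0) \<and>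
     (AE \<omega> in M. continuous_on {0..1} (\<lambda>t. G t \<omega>))"

definition solves_equation ::
    "'a measure \<Rightarrow> (real \<Rightarrow> 'a \<Rightarrow> real) \<Rightarrow> real \<Rightarrow> real \<Rightarrow> real \<Rightarrow> (real \<Rightarrow> 'a \<Rightarrow> real) \<Rightarrow> bool" where
  "solves_equation M G x0 \<theta> \<epsilon> X \<longleftrightarrow>
     (AE \<omega> in M.
        (\<lambda>s. X s \<omega>) integrable_on {0..1} \<and>
        X 0 \<omega> = x0 \<and>
        (\<forall>t\<in>{0..1}. X t \<omega> = x0 + \<theta> * integral {0..t} (\<lambda>s. X s \<omega>) + \<epsilon> * G t \<omega>))"

definition x_det :: "real \<Rightarrow> real \<Rightarrow> real \<Rightarrow> real" where
  "x_det x0 \<theta> t = x0 * exp (\<theta> * t)"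

definition S1 :: "real \<Rightarrow> (real \<Rightarrow> 'a \<Rightarrow> real) \<Rightarrow> 'a \<Rightarrow> real \<Rightarrow> real" where
  "S1 x0 X \<omega> \<theta> = integral {0..1} (\<lambda>t. \<bar>X t \<omega> - x_det x0 \<theta> t\<bar>)"

definition minimum_L1_norm_estimator ::
    "'a measure \<Rightarrow> real set \<Rightarrow> real \<Rightarrow> (real \<Rightarrow> 'a \<Rightarrow> real) \<Rightarrow> ('a \<Rightarrow> real) \<Rightarrow> bool" where
  "minimum_L1_norm_estimator M \<Theta> x0 X \<theta>s \<longleftrightarrow>
     \<theta>s \<in> borel_measurable M \<and>
     (\<forall>\<omega>\<in>space M. \<theta>s \<omega> \<in> \<Theta>) \<and>
     (AE \<omega> in M. S1 x0 X \<omega> (\<theta>s \<omega>) = (INF \<theta>\<in>\<Theta>. S1 x0 X \<omega> \<theta>))"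

text \<open>The Young integral of \<open>f\<close> against \<open>g\<close> is the limit of the Riemann--Stieltjes sums as the mesh
  of the tagged division tends to \<open>0\<close>. For a smooth \<open>f\<close> the limit exists for every continuous
  \<open>g\<close>, so no variation condition on \<open>g\<close> is part of the definition.\<close>

definition has_young_integral ::
    "(real \<Rightarrow> real) \<Rightarrow> (real \<Rightarrow> real) \<Rightarrow> real \<Rightarrow> real \<Rightarrow> real \<Rightarrow> bool" where
  "has_young_integral f g a b I \<longleftrightarrow>
     (\<forall>e>0. \<exists>d>0. \<forall>p. p tagged_division_of {a..b} \<and> (\<forall>(s, K)\<in>p. Sup K - Inf K < d) \<longrightarrow>
        \<bar>(\<Sum>(s, K)\<in>p. f s * (g (Sup K) - g (Inf K))) - I\<bar> < e)"

definition young_integral :: "(real \<Rightarrow> real) \<Rightarrow> (real \<Rightarrow> real) \<Rightarrow> real \<Rightarrow> real \<Rightarrow> real" where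
  "young_integral f g a b = (THE I. has_young_integral f g a b I)"

definition Y_process :: "real \<Rightarrow> (real \<Rightarrow> 'a \<Rightarrow> real) \<Rightarrow> real \<Rightarrow> 'a \<Rightarrow> real" where
  "Y_process \<theta>0 G t \<omega> =
     exp (\<theta>0 * t) * young_integral (\<lambda>s. exp (- \<theta>0 * s)) (\<lambda>s. G s \<omega>) 0 t"

definition zeta_objective ::
    "real \<Rightarrow> real \<Rightarrow> (real \<Rightarrow> 'a \<Rightarrow> real) \<Rightarrow> 'a \<Rightarrow> real \<Rightarrow> real" where
  "zeta_objective x0 \<theta>0 G \<omega> u =
     integral {0..1} (\<lambda>t. \<bar>Y_process \<theta>0 G t \<omega> - u * t * x0 * exp (\<theta>0 * t)\<bar>)"

definition zeta :: "real \<Rightarrow> real \<Rightarrow> (real \<Rightarrow> 'a \<Rightarrow> real) \<Rightarrow> 'a \<Rightarrow> real" where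
  "zeta x0 \<theta>0 G \<omega> = arg_min (zeta_objective x0 \<theta>0 G \<omega>) (\<lambda>_. True)"

text \<open>Convergence in probability of the family \<open>V \<epsilon>\<close>, \<open>\<epsilon> > 0\<close>, as \<open>\<epsilon>\<close> decreases to \<open>0\<close>.\<close>

definition converges_in_probability_at_0 ::
    "'a measure \<Rightarrow> (real \<Rightarrow> 'a \<Rightarrow> real) \<Rightarrow> ('a \<Rightarrow> real) \<Rightarrow> bool" where
  "converges_in_probability_at_0 M V Z \<longleftrightarrow>
     (\<forall>\<delta>>0. ((\<lambda>\<epsilon>. measure M {\<omega> \<in> space M. \<bar>V \<epsilon> \<omega> - Z \<omega>\<bar> > \<delta>}) \<longlongrightarrow> 0) (at_right 0))"

end

theory Submission
  imports Defs
begin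

text \<open>Integration by parts makes \<open>Y\<close> an explicit continuous functional of the path of \<open>G\<close>, and solving
  the linear equation gives \<open>X\<^sub>t = x\<^sub>t(\<theta>0) + \<epsilon> Y\<^sub>t\<close>. Everything else happens path by path. The limit
  objective \<open>h(u) = \<integral>\<bar>Y\<^sub>t - u t x0 exp(\<theta>0 t)\<bar> dt\<close> is convex and coercive, and its minimiser is unique
  because \<open>t x0 exp(\<theta>0 t)\<close> does not vanish inside the interval. Identifiability of \<open>\<theta>\<close> bounds
  \<open>u = (\<theta>\<^sub>\<epsilon> - \<theta>0)/\<epsilon>\<close>, and on bounded sets the rescaled criterion \<open>S1(\<theta>0 + \<epsilon> u)/\<epsilon>\<close> converges uniformly to \<open>h\<close>,
  so along each sequence \<open>\<epsilon>\<^sub>n \<rightarrow> 0\<close> the rescaled estimators converge almost surely to \<open>\<zeta>\<close>. This gives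
  convergence in probability with \<open>Z = \<zeta>\<close>, and also the measurability of \<open>\<zeta>\<close>, as the filtered space is complete.\<close>

section \<open>Young integrals of continuously differentiable integrands\<close>

text \<open>The boundary terms minus \<open>f s * (g d - g c)\<close> equal
  \<open>g c * (f s - f c) + g d * (f d - f s)\<close>. Writing the increments of \<open>f\<close>
  as integrals of \<open>f'\<close> shows that the error consists of integrals of \<open>f'\<close>
  against the deviation of \<open>g\<close> from an endpoint value.\<close>

lemma young_increment_bound:
  fixes f f' g :: "real \<Rightarrow> real"
  assumes deriv: "\<And>x. x \<in> {c..d} \<Longrightarrow> (f has_real_derivative f' x) (at x within {c..d})"
    and cf': "continuous_on {c..d} f'" and cg: "continuous_on {c..d} g"
    and s: "s \<in> {c..d}"
    and B: "\<And>x. x \<in> {c..d} \<Longrightarrow> \<bar>f' x\<bar> \<le> B"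
    and osc: "\<And>x y. x \<in> {c..d} \<Longrightarrow> y \<in> {c..d} \<Longrightarrow> \<bar>g x - g y\<bar> \<le> \<eta>"
  shows "\<bar>f d * g d - f c * g c - f s * (g d - g c) - integral {c..d} (\<lambda>x. f' x * g x)\<bar>
           \<le> B * \<eta> * (d - c)"
proof -
  \<comment> \<open>Here \<open>r\<close> stands for the endpoint value of \<open>g\<close> that
    replaces \<open>g\<close> on one side of the tag: \<open>g c\<close> to its left,
    \<open>g d\<close> to its right.\<close>
  have piece: "f q - f p = integral {p..q} f' \<and>
      \<bar>r * (f q - f p) - integral {p..q} (\<lambda>x. f' x * g x)\<bar> \<le> B * \<eta> * (q - p)"
    if pq: "p \<le> q" "{p..q} \<subseteq> {c..d}" and r: "\<And>x. x \<in> {p..q} \<Longrightarrow> \<bar>r - g x\<bar> \<le> \<eta>" for p q r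
  proof -
    have cf: "continuous_on {p..q} f'" and cgg: "continuous_on {p..q} g"
      using cf' cg pq(2) continuous_on_subset by blast+
    have "(f' has_integral (f q - f p)) {p..q}"
    proof (rule fundamental_theorem_of_calculus[OF pq(1)])
      show "(f has_vector_derivative f' x) (at x within {p..q})" if "x \<in> {p..q}" for x
        using that pq(2) has_field_derivative_subset[OF deriv]
        by (auto simp flip: has_real_derivative_iff_has_vector_derivative)
    qed
    then have f: "integral {p..q} f' = f q - f p" by blast
    have "r * (f q - f p) - integral {p..q} (\<lambda>x. f' x * g x)
        = integral {p..q} (\<lambda>x. r * f' x) - integral {p..q} (\<lambda>x. f' x * g x)"
      by (simp flip: f)
    also have "\<dots> = integral {p..q} (\<lambda>x. r * f' x - f' x * g x)"
      by (intro integral_diff[symmetric] integrable_continuous_real continuous_intros cf cgg)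
    also have "\<dots> = integral {p..q} (\<lambda>x. f' x * (r - g x))"
      by (simp add: algebra_simps)
    also have "norm \<dots> \<le> B * \<eta> * (q - p)"
    proof (rule integral_bound)
      fix x assume x: "x \<in> {p..q}"
      then have "\<bar>f' x\<bar> * \<bar>r - g x\<bar> \<le> B * \<eta>"
        using B[of x] r[OF x] pq(2) by (intro mult_mono) (auto intro: order_trans[OF abs_ge_zero])
      then show "norm (f' x * (r - g x)) \<le> B * \<eta>" by (simp add: abs_mult)
    qed (use pq in \<open>auto intro!: continuous_intros cf cgg\<close>)
    finally show ?thesis using f by simp
  qed
  have left: "\<bar>g c * (f s - f c) - integral {c..s} (\<lambda>x. f' x * g x)\<bar> \<le> B * \<eta> * (s - c)"
    using piece[of c s "g c"] s osc by auto
  have right: "\<bar>g d * (f d - f s) - integral {s..d} (\<lambda>x. f' x * g x)\<bar> \<le> B * \<eta> * (d - s)"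
    using piece[of s d "g d"] s osc by auto
  have "integral {c..s} (\<lambda>x. f' x * g x) + integral {s..d} (\<lambda>x. f' x * g x)
      = integral {c..d} (\<lambda>x. f' x * g x)"
    using s by (intro Henstock_Kurzweil_Integration.integral_combine integrable_continuous_real
        continuous_intros cf' cg) auto
  then have "f d * g d - f c * g c - f s * (g d - g c) - integral {c..d} (\<lambda>x. f' x * g x)
     = (g c * (f s - f c) - integral {c..s} (\<lambda>x. f' x * g x))
       + (g d * (f d - f s) - integral {s..d} (\<lambda>x. f' x * g x))"
    by (simp add: algebra_simps)
  moreover have "B * \<eta> * (s - c) + B * \<eta> * (d - s) = B * \<eta> * (d - c)"
    by (simp add: algebra_simps)
  ultimately show ?thesis using left right by linarith
qed

text \<open>The one-interval bound is summed over the division. The mesh controls the oscillation of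
  \<open>g\<close> by uniform continuity, so continuity of \<open>g\<close> suffices and no
  variation of \<open>g\<close> enters.\<close>

lemma has_young_integral_by_parts:
  fixes f f' g :: "real \<Rightarrow> real"
  assumes ab: "a \<le> b"
    and deriv: "\<And>x. x \<in> {a..b} \<Longrightarrow> (f has_real_derivative f' x) (at x within {a..b})"
    and cf': "continuous_on {a..b} f'" and cg: "continuous_on {a..b} g"
  shows "has_young_integral f g a b (f b * g b - f a * g a - integral {a..b} (\<lambda>x. f' x * g x))"
  unfolding has_young_integral_def
proof (intro allI impI)
  fix e :: real assume e: "e > 0"
  have "compact (f' ` {a..b})"
    using cf' by (rule compact_continuous_image) auto
  then obtain B where B0: "B > 0" and B: "\<And>x. x \<in> {a..b} \<Longrightarrow> \<bar>f' x\<bar> \<le> B"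
    using compact_imp_bounded bounded_pos by (metis imageI real_norm_def)
  \<comment> \<open>The summand 1 keeps \<open>l\<close> positive when \<open>a = b\<close>; then
    \<open>\<eta>\<close> makes the total error at most \<open>e / 2\<close>.\<close>
  define l where "l = b - a + 1"
  have l: "l > 0" using ab by (simp add: l_def)
  define \<eta> where "\<eta> = e / (2 * B * l)"
  have \<eta>: "\<eta> > 0" using e B0 l by (simp add: \<eta>_def)
  have small: "B * \<eta> * (b - a) < e"
  proof -
    have "B * \<eta> * (b - a) \<le> B * \<eta> * l" using B0 \<eta> by (simp add: l_def)
    also have "\<dots> = e / 2" using B0 l by (simp add: \<eta>_def)
    finally show ?thesis using e by simp
  qed
  have "uniformly_continuous_on {a..b} g"
    using cg by (intro compact_uniformly_continuous) auto
  then obtain d where d: "d > 0" and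
    osc: "\<And>x y. x \<in> {a..b} \<Longrightarrow> y \<in> {a..b} \<Longrightarrow> \<bar>x - y\<bar> < d \<Longrightarrow> \<bar>g x - g y\<bar> < \<eta>"
    using \<eta> unfolding uniformly_continuous_on_def dist_real_def by metis
  show "\<exists>d>0. \<forall>p. p tagged_division_of {a..b} \<and> (\<forall>(s, K)\<in>p. Sup K - Inf K < d) \<longrightarrow>
      \<bar>(\<Sum>(s, K)\<in>p. f s * (g (Sup K) - g (Inf K)))
        - (f b * g b - f a * g a - integral {a..b} (\<lambda>x. f' x * g x))\<bar> < e"
  proof (intro exI conjI allI impI)
    fix p :: "(real \<times> real set) set"
    assume "p tagged_division_of {a..b} \<and> (\<forall>(s, K)\<in>p. Sup K - Inf K < d)"
    then have p: "p tagged_division_of {a..b}" and mesh: "\<And>s K. (s, K) \<in> p \<Longrightarrow> Sup K - Inf K < d"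
      by auto
    \<comment> \<open>The error of a single tagged interval. Boundary terms telescope and integrals
      add up, so the sum of \<open>\<Delta>\<close> is the claimed value minus the
      Riemann--Stieltjes sum.\<close>
    define \<Delta> where "\<Delta> = (\<lambda>(s, K). f (Sup K) * g (Sup K) - f (Inf K) * g (Inf K)
        - f s * (g (Sup K) - g (Inf K)) - integral K (\<lambda>x. f' x * g x))"
    have term_bound: "norm (\<Delta> x) \<le> (\<lambda>(s, K). B * \<eta> * (Sup K - Inf K)) x" if x: "x \<in> p" for x
    proof -
      obtain s K where xs: "x = (s, K)" by (cases x)
      have sK: "(s, K) \<in> p" using x xs by simp
      obtain c e where K: "K = {c..e}" using tagged_division_ofD(4)[OF p sK] by auto
      have s: "s \<in> {c..e}" and sub: "{c..e} \<subseteq> {a..b}"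
        using tagged_division_ofD(2,3)[OF p sK] K by auto
      have "\<bar>f e * g e - f c * g c - f s * (g e - g c) - integral {c..e} (\<lambda>x. f' x * g x)\<bar>
          \<le> B * \<eta> * (e - c)"
      proof (rule young_increment_bound[OF _ _ _ s])
        show "(f has_real_derivative f' x) (at x within {c..e})" if "x \<in> {c..e}" for x
          using that sub deriv has_field_derivative_subset by blast
        show "continuous_on {c..e} f'" "continuous_on {c..e} g"
          using cf' cg sub continuous_on_subset by blast+
        show "\<bar>g x - g y\<bar> \<le> \<eta>" if "x \<in> {c..e}" "y \<in> {c..e}" for x y
        proof -
          have "e - c < d" using mesh[OF sK] s by (simp add: K)
          then have "\<bar>x - y\<bar> < d" using that by auto
          then show ?thesis using that sub osc[of x y] by fastforce
        qed
      qed (use B sub in auto)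
      then show ?thesis using s by (simp add: xs \<Delta>_def K)
    qed
    have "sum \<Delta> p = (f b * g b - f a * g a) - (\<Sum>(s, K)\<in>p. f s * (g (Sup K) - g (Inf K)))
        - integral {a..b} (\<lambda>x. f' x * g x)"
    proof -
      have "(\<lambda>x. f' x * g x) integrable_on {a..b}"
        by (intro integrable_continuous_real continuous_intros cf' cg)
      then have "integral {a..b} (\<lambda>x. f' x * g x) = (\<Sum>(s, K)\<in>p. integral K (\<lambda>x. f' x * g x))"
        using integral_combine_tagged_division_topdown[of "\<lambda>x. f' x * g x" a b p] p by simp
      moreover have "(\<Sum>(s, K)\<in>p. f (Sup K) * g (Sup K) - f (Inf K) * g (Inf K))
          = f b * g b - f a * g a"
        using additive_tagged_division_1[OF ab p, of "\<lambda>x. f x * g x"] .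
      ultimately show ?thesis
        by (simp add: \<Delta>_def case_prod_unfold sum_subtractf)
    qed
    moreover have "norm (sum \<Delta> p) \<le> B * \<eta> * (b - a)"
    proof -
      have "norm (sum \<Delta> p) \<le> (\<Sum>(s, K)\<in>p. B * \<eta> * (Sup K - Inf K))"
        using term_bound by (rule sum_norm_le)
      also have "\<dots> = B * \<eta> * (b - a)"
        using additive_tagged_division_1[OF ab p, of "\<lambda>x. x"]
        by (simp add: case_prod_unfold flip: sum_distrib_left)
      finally show ?thesis .
    qed
    ultimately show "\<bar>(\<Sum>(s, K)\<in>p. f s * (g (Sup K) - g (Inf K)))
        - (f b * g b - f a * g a - integral {a..b} (\<lambda>x. f' x * g x))\<bar> < e"
      using small by (simp add: abs_if split: if_splits)
  qed (use d in auto)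
qed

text \<open>By Cousin's lemma some tagged division is finer than both mesh thresholds; its sum would
  lie within half of \<open>\<bar>I - J\<bar>\<close> of both values.\<close>

lemma has_young_integral_unique:
  assumes I: "has_young_integral f g a b I" and J: "has_young_integral f g a b J"
  shows "I = J"
proof (rule ccontr)
  assume "I \<noteq> J"
  define e where "e = \<bar>I - J\<bar> / 2"
  have e: "e > 0" using \<open>I \<noteq> J\<close> by (simp add: e_def)
  obtain d1 where d1: "d1 > 0" "\<And>p. p tagged_division_of {a..b} \<Longrightarrow> (\<forall>(s, K)\<in>p. Sup K - Inf K < d1)
      \<Longrightarrow> \<bar>(\<Sum>(s, K)\<in>p. f s * (g (Sup K) - g (Inf K))) - I\<bar> < e"
    using I[unfolded has_young_integral_def, rule_format, OF e] by blast
  obtain d2 where d2: "d2 > 0" "\<And>p. p tagged_division_of {a..b} \<Longrightarrow> (\<forall>(s, K)\<in>p. Sup K - Inf K < d2)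
      \<Longrightarrow> \<bar>(\<Sum>(s, K)\<in>p. f s * (g (Sup K) - g (Inf K))) - J\<bar> < e"
    using J[unfolded has_young_integral_def, rule_format, OF e] by blast
  \<comment> \<open>An interval inside a ball of radius \<open>d\<close> around its tag has length
    below \<open>2 * d\<close>, hence the half.\<close>
  define d where "d = min d1 d2 / 2"
  have "gauge (\<lambda>x. ball x d)" using d1 d2 by (intro gauge_ball) (simp add: d_def)
  then obtain p where p: "p tagged_division_of {a..b}" "(\<lambda>x. ball x d) fine p"
    by (rule fine_division_exists_real)
  have "Sup K - Inf K < min d1 d2" if sK: "(s, K) \<in> p" for s K
  proof -
    obtain c e where K: "K = {c..e}" using tagged_division_ofD(4)[OF p(1) sK] by auto
    have "s \<in> {c..e}" using tagged_division_ofD(2)[OF p(1) sK] K by auto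
    then have "c \<in> K" "e \<in> K" "c \<le> e" by (auto simp: K)
    then have "c \<in> ball s d" "e \<in> ball s d" "c \<le> e"
      using fineD[OF p(2) sK] by blast+
    then have "e - c < 2 * d" by (simp add: dist_real_def abs_if split: if_splits)
    then show ?thesis using \<open>c \<le> e\<close> by (simp add: K d_def)
  qed
  then have "\<bar>(\<Sum>(s, K)\<in>p. f s * (g (Sup K) - g (Inf K))) - I\<bar> < e"
    "\<bar>(\<Sum>(s, K)\<in>p. f s * (g (Sup K) - g (Inf K))) - J\<bar> < e"
    by (intro d1(2) d2(2) p(1); fastforce)+
  then show False by (simp add: e_def abs_if split: if_splits)
qed

lemma young_integral_eq: "has_young_integral f g a b I \<Longrightarrow> young_integral f g a b = I"
  unfolding young_integral_def by (blast intro: has_young_integral_unique)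

section \<open>Explicit formulas for \<open>Y\<close> and for the solution \<open>X\<close>\<close>

text \<open>Integration by parts with the integrand \<open>exp (- \<theta> * s)\<close>. The term
  with \<open>G 0\<close> stays here; it vanishes only once a solution of the equation for
  \<open>X\<close> is given.\<close>

lemma Y_process_eq:
  assumes cont: "continuous_on {0..1} (\<lambda>t. G t \<omega>)" and t: "t \<in> {0..1}"
  shows "Y_process \<theta> G t \<omega> = G t \<omega> - exp (\<theta> * t) * G 0 \<omega>
      + \<theta> * exp (\<theta> * t) * integral {0..t} (\<lambda>s. exp (- \<theta> * s) * G s \<omega>)"
proof -
  have "continuous_on {0..t} (\<lambda>s. G s \<omega>)"
    using cont t by (auto elim: continuous_on_subset)
  then have "has_young_integral (\<lambda>s. exp (- \<theta> * s)) (\<lambda>s. G s \<omega>) 0 t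
      (exp (- \<theta> * t) * G t \<omega> - exp (- \<theta> * 0) * G 0 \<omega>
        - integral {0..t} (\<lambda>s. (- \<theta> * exp (- \<theta> * s)) * G s \<omega>))"
    using t by (intro has_young_integral_by_parts)
      (auto intro!: derivative_eq_intros continuous_intros)
  from young_integral_eq[OF this]
  have "young_integral (\<lambda>s. exp (- \<theta> * s)) (\<lambda>s. G s \<omega>) 0 t
      = exp (- \<theta> * t) * G t \<omega> - G 0 \<omega> + \<theta> * integral {0..t} (\<lambda>s. exp (- \<theta> * s) * G s \<omega>)"
    by (simp add: mult.assoc)
  moreover have "exp (\<theta> * t) * exp (- \<theta> * t) = 1"
    by (simp flip: exp_add)
  ultimately show ?thesis
    by (simp add: Y_process_def distrib_left right_diff_distrib flip: mult.assoc)
qed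

lemma continuous_on_Y_process:
  assumes cont: "continuous_on {0..1} (\<lambda>t. G t \<omega>)"
  shows "continuous_on {0..1} (\<lambda>t. Y_process \<theta> G t \<omega>)"
proof -
  have "continuous_on {0..1} (\<lambda>t. G t \<omega> - exp (\<theta> * t) * G 0 \<omega>
      + \<theta> * exp (\<theta> * t) * integral {0..t} (\<lambda>s. exp (- \<theta> * s) * G s \<omega>))"
    by (intro continuous_intros indefinite_integral_continuous_1 integrable_continuous_real cont)
  then show ?thesis
    by (rule continuous_on_eq) (rule Y_process_eq[of G \<omega>, OF cont, symmetric])
qed

text \<open>Integrating factor: the derivative of
  \<open>exp (- \<theta> * s) * integral {0..s} D\<close> is
  \<open>exp (- \<theta> * s) * g s\<close>.\<close>

lemma linear_integral_equation_solution:
  fixes D g :: "real \<Rightarrow> real"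
  assumes cg: "continuous_on {0..1} g" and int: "D integrable_on {0..1}"
    and eq: "\<And>t. t \<in> {0..1} \<Longrightarrow> D t = \<theta> * integral {0..t} D + g t"
    and t: "t \<in> {0..1}"
  shows "D t = g t + \<theta> * exp (\<theta> * t) * integral {0..t} (\<lambda>s. exp (- \<theta> * s) * g s)"
proof -
  \<comment> \<open>\<open>D\<close> is only assumed integrable; the equation itself makes it
    continuous, so that its indefinite integral can be differentiated.\<close>
  have "continuous_on {0..1} (\<lambda>t. \<theta> * integral {0..t} D + g t)"
    by (intro continuous_intros indefinite_integral_continuous_1 int cg)
  then have cD: "continuous_on {0..1} D"
    by (rule continuous_on_eq) (rule eq[symmetric])
  have "((\<lambda>s. exp (- \<theta> * s) * g s) has_integral
      (exp (- \<theta> * t) * integral {0..t} D - exp (- \<theta> * 0) * integral {0..0} D)) {0..t}"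
  proof (rule fundamental_theorem_of_calculus)
    fix s assume s: "s \<in> {0..t}"
    then have s1: "s \<in> {0..1}" using t by auto
    have I: "((\<lambda>x. integral {0..x} D) has_real_derivative D s) (at s within {0..t})"
      using has_field_derivative_subset[OF integral_has_real_derivative[OF cD s1]] t by auto
    have "((\<lambda>x. exp (- \<theta> * x) * integral {0..x} D) has_real_derivative
        exp (- \<theta> * s) * D s - \<theta> * exp (- \<theta> * s) * integral {0..s} D) (at s within {0..t})"
      by (rule derivative_eq_intros I refl)+ simp
    also have "exp (- \<theta> * s) * D s - \<theta> * exp (- \<theta> * s) * integral {0..s} D
        = exp (- \<theta> * s) * g s"
      using eq[OF s1] by (simp add: algebra_simps)
    finally show "((\<lambda>x. exp (- \<theta> * x) * integral {0..x} D) has_vector_derivative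
        exp (- \<theta> * s) * g s) (at s within {0..t})"
      by (simp add: has_real_derivative_iff_has_vector_derivative)
  qed (use t in auto)
  then have "integral {0..t} (\<lambda>s. exp (- \<theta> * s) * g s) = exp (- \<theta> * t) * integral {0..t} D"
    by (simp add: integral_unique)
  moreover have "exp (\<theta> * t) * exp (- \<theta> * t) = 1"
    by (simp flip: exp_add)
  ultimately have "exp (\<theta> * t) * integral {0..t} (\<lambda>s. exp (- \<theta> * s) * g s) = integral {0..t} D"
    by (simp flip: mult.assoc)
  then show ?thesis
    using eq[OF t] by (simp add: mult.assoc)
qed

text \<open>The previous formula with forcing term \<open>x0 + \<epsilon> * G\<close>: the constant
  part produces the noiseless curve, the rest produces \<open>Y\<close>.\<close>

lemma solution_eq_Y_process:
  fixes x :: "real \<Rightarrow> real"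
  assumes \<epsilon>: "\<epsilon> > 0" and cont: "continuous_on {0..1} (\<lambda>t. G t \<omega>)"
    and int: "x integrable_on {0..1}" and x0: "x 0 = x0"
    and eq: "\<forall>t\<in>{0..1}. x t = x0 + \<theta> * integral {0..t} x + \<epsilon> * G t \<omega>"
    and t: "t \<in> {0..1}"
  shows "x t = x_det x0 \<theta> t + \<epsilon> * Y_process \<theta> G t \<omega>"
proof -
  \<comment> \<open>The equation at time 0 and the initial condition force \<open>G\<close> to start
    at 0 on this path.\<close>
  have "x 0 = x0 + \<epsilon> * G 0 \<omega>" using eq by auto
  then have G0: "G 0 \<omega> = 0" using x0 \<epsilon> by simp
  define E where "E = integral {0..t} (\<lambda>s. exp (- \<theta> * s))"
  have "x t = (x0 + \<epsilon> * G t \<omega>)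
      + \<theta> * exp (\<theta> * t) * integral {0..t} (\<lambda>s. exp (- \<theta> * s) * (x0 + \<epsilon> * G s \<omega>))"
    using eq by (intro linear_integral_equation_solution[OF _ int _ t] continuous_intros cont) auto
  also have "integral {0..t} (\<lambda>s. exp (- \<theta> * s) * (x0 + \<epsilon> * G s \<omega>))
      = integral {0..t} (\<lambda>s. x0 * exp (- \<theta> * s) + \<epsilon> * (exp (- \<theta> * s) * G s \<omega>))"
    by (simp add: algebra_simps)
  also have "\<dots> = x0 * E + \<epsilon> * integral {0..t} (\<lambda>s. exp (- \<theta> * s) * G s \<omega>)"
  proof -
    have "continuous_on {0..t} (\<lambda>s. G s \<omega>)"
      using cont t by (auto elim: continuous_on_subset)
    then show ?thesis unfolding E_def
      by (subst integral_add) (auto intro!: integrable_continuous_real continuous_intros)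
  qed
  also have "\<theta> * exp (\<theta> * t) * (x0 * E + \<epsilon> * integral {0..t} (\<lambda>s. exp (- \<theta> * s) * G s \<omega>))
      = x0 * (exp (\<theta> * t) * (\<theta> * E)) + \<epsilon> * (\<theta> * exp (\<theta> * t) * integral {0..t} (\<lambda>s. exp (- \<theta> * s) * G s \<omega>))"
    by (simp add: algebra_simps)
  \<comment> \<open>Keeping the factor \<open>\<theta>\<close> on \<open>E\<close> avoids a separate
    case for \<open>\<theta> = 0\<close>.\<close>
  also have "\<theta> * E = 1 - exp (- \<theta> * t)"
  proof -
    have "((\<lambda>s. \<theta> * exp (- \<theta> * s)) has_integral (- exp (- \<theta> * t) - - exp (- \<theta> * 0))) {0..t}"
      using t by (intro fundamental_theorem_of_calculus)
        (auto simp flip: has_real_derivative_iff_has_vector_derivative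
              intro!: derivative_eq_intros)
    from integral_unique[OF this] show ?thesis
      unfolding E_def by (subst (asm) integral_mult_right) simp
  qed
  also have "exp (\<theta> * t) * (1 - exp (- \<theta> * t)) = exp (\<theta> * t) - 1"
    by (simp add: right_diff_distrib flip: exp_add)
  finally show ?thesis
    using Y_process_eq[of G \<omega>, OF cont t, of \<theta>] G0 by (simp add: x_det_def algebra_simps)
qed

section \<open>Convexity and the best L1 fit of a path by multiples of a fixed function\<close>

lemma continuous_nonzero_constant_sign:
  fixes f :: "real \<Rightarrow> real"
  assumes "continuous_on S f" "connected S" "\<And>x. x \<in> S \<Longrightarrow> f x \<noteq> 0"
  shows "(\<forall>x\<in>S. f x > 0) \<or> (\<forall>x\<in>S. f x < 0)"
proof (rule ccontr)
  assume "\<not> ?thesis"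
  then obtain x y where "x \<in> S" "f x < 0" "y \<in> S" "f y > 0"
    using assms(3) by (metis linorder_neqE_linordered_idom)
  moreover have "connected (f ` S)"
    using assms by (intro connected_continuous_image)
  ultimately have "0 \<in> f ` S"
    by (meson connectedD_interval imageI less_imp_le)
  then show False using assms(3) by auto
qed

text \<open>By convexity the values at distance exactly \<open>\<delta>\<close> from the minimiser
  bound all values farther out, so the gap needs to be measured only at \<open>z + \<delta>\<close>
  and \<open>z - \<delta>\<close>.\<close>

lemma convex_strict_minimum_separated:
  fixes h :: "real \<Rightarrow> real"
  assumes conv: "convex_on UNIV h" and min: "\<And>u. u \<noteq> z \<Longrightarrow> h z < h u" and \<delta>: "\<delta> > 0"
  obtains \<eta> where "\<eta> > 0" "\<And>u. \<delta> \<le> \<bar>u - z\<bar> \<Longrightarrow> h z + \<eta> \<le> h u"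
proof
  define \<eta> where "\<eta> = min (h (z + \<delta>)) (h (z - \<delta>)) - h z"
  show "\<eta> > 0" using min[of "z + \<delta>"] min[of "z - \<delta>"] \<delta> by (simp add: \<eta>_def)
  fix u assume u: "\<delta> \<le> \<bar>u - z\<bar>"
  \<comment> \<open>With this weight the convex combination of \<open>z\<close> and \<open>u\<close>
    is the point at distance \<open>\<delta>\<close> from \<open>z\<close> on the side of
    \<open>u\<close>.\<close>
  define s where "s = \<delta> / \<bar>u - z\<bar>"
  have s: "0 \<le> s" "s \<le> 1" using u \<delta> by (auto simp: s_def)
  have "h ((1 - s) *\<^sub>R z + s *\<^sub>R u) \<le> (1 - s) * h z + s * h u"
    using s by (intro convex_onD[OF conv]) auto
  also have "\<dots> \<le> h u"
  proof -
    have "h z \<le> h u" using min[of u] by (cases "u = z") auto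
    then have "(1 - s) * h z \<le> (1 - s) * h u" using s by (intro mult_left_mono) auto
    then show ?thesis by (simp add: algebra_simps)
  qed
  finally have "h (z + s * (u - z)) \<le> h u" by (simp add: algebra_simps)
  moreover have "s * (u - z) = \<delta> \<or> s * (u - z) = - \<delta>"
    using u \<delta> by (cases "u \<ge> z") (auto simp: s_def field_simps)
  ultimately show "h z + \<eta> \<le> h u" by (auto simp: \<eta>_def)
qed

text \<open>\<open>\<phi>\<close> may vanish at the endpoints because the direction used later is
  zero at time 0.\<close>

locale L1_line =
  fixes a b :: real and Y \<phi> :: "real \<Rightarrow> real"
  assumes ab: "a < b"
    and cont_Y: "continuous_on {a..b} Y" and cont_\<phi>: "continuous_on {a..b} \<phi>"
    and nonzero: "\<And>t. t \<in> {a<..<b} \<Longrightarrow> \<phi> t \<noteq> 0"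
begin

definition h :: "real \<Rightarrow> real" where
  "h u = integral {a..b} (\<lambda>t. \<bar>Y t - u * \<phi> t\<bar>)"

definition N :: real where
  "N = integral {a..b} (\<lambda>t. \<bar>\<phi> t\<bar>)"

lemma integrable_h: "(\<lambda>t. \<bar>Y t - u * \<phi> t\<bar>) integrable_on {a..b}"
  by (intro integrable_continuous_real continuous_intros cont_Y cont_\<phi>)

lemma integrable_N: "(\<lambda>t. \<bar>\<phi> t\<bar>) integrable_on {a..b}"
  by (intro integrable_continuous_real continuous_intros cont_\<phi>)

lemma midpoint: "(a + b) / 2 \<in> {a<..<b}"
  using ab by auto

lemma N_pos: "N > 0"
proof -
  have "N \<ge> 0" unfolding N_def by (intro integral_nonneg integrable_N) auto
  moreover have "N \<noteq> 0"
  proof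
    assume "N = 0"
    moreover have "continuous_on {a..b} (\<lambda>t. \<bar>\<phi> t\<bar>)" by (intro continuous_intros cont_\<phi>)
    ultimately have "\<forall>t\<in>{a..b}. \<bar>\<phi> t\<bar> = 0"
      using ab unfolding N_def by (subst (asm) integral_eq_0_iff) auto
    then show False using nonzero[OF midpoint] midpoint by auto
  qed
  ultimately show ?thesis by linarith
qed

lemma h_nonneg: "h u \<ge> 0"
  unfolding h_def by (intro integral_nonneg integrable_h) auto

lemma convex_h: "convex_on UNIV h"
proof (rule convex_onI)
  fix s u v :: real assume s: "0 < s" "s < 1"
  have "h ((1 - s) * u + s * v)
      \<le> integral {a..b} (\<lambda>t. (1 - s) * \<bar>Y t - u * \<phi> t\<bar> + s * \<bar>Y t - v * \<phi> t\<bar>)"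
    unfolding h_def
  proof (rule integral_le)
    fix t
    have "Y t - ((1 - s) * u + s * v) * \<phi> t = (1 - s) * (Y t - u * \<phi> t) + s * (Y t - v * \<phi> t)"
      by (simp add: algebra_simps)
    also have "\<bar>\<dots>\<bar> \<le> \<bar>(1 - s) * (Y t - u * \<phi> t)\<bar> + \<bar>s * (Y t - v * \<phi> t)\<bar>"
      by (rule abs_triangle_ineq)
    finally show "\<bar>Y t - ((1 - s) * u + s * v) * \<phi> t\<bar>
        \<le> (1 - s) * \<bar>Y t - u * \<phi> t\<bar> + s * \<bar>Y t - v * \<phi> t\<bar>"
      using s by (simp add: abs_mult)
  qed (intro integrable_continuous_real continuous_intros cont_Y cont_\<phi>)+
  also have "\<dots> = (1 - s) * h u + s * h v"
    unfolding h_def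
    by (subst integral_add)
      (auto intro!: integrable_continuous_real continuous_intros cont_Y cont_\<phi>)
  finally show "h ((1 - s) *\<^sub>R u + s *\<^sub>R v) \<le> (1 - s) * h u + s * h v" by simp
qed simp

lemma continuous_h: "continuous_on S h"
  using convex_on_continuous[OF open_UNIV convex_h] continuous_on_subset by blast

text \<open>Triangle inequality for \<open>u * \<phi> t\<close> as a difference of two residuals:
  that of slope 0, whose integral \<open>h 0\<close> is the L1 norm of \<open>Y\<close>, and that of
  slope \<open>u\<close>.\<close>

lemma h_coercive: "\<bar>u\<bar> * N \<le> h u + h 0"
proof -
  have "\<bar>u\<bar> * N = integral {a..b} (\<lambda>t. \<bar>u\<bar> * \<bar>\<phi> t\<bar>)" by (simp add: N_def)
  also have "\<dots> \<le> integral {a..b} (\<lambda>t. \<bar>Y t - u * \<phi> t\<bar> + \<bar>Y t - 0 * \<phi> t\<bar>)"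
  proof (rule integral_le)
    show "\<bar>u\<bar> * \<bar>\<phi> t\<bar> \<le> \<bar>Y t - u * \<phi> t\<bar> + \<bar>Y t - 0 * \<phi> t\<bar>" for t
      unfolding abs_mult[symmetric] by simp
  qed (intro integrable_continuous_real continuous_intros cont_Y cont_\<phi>)+
  also have "\<dots> = h u + h 0"
    unfolding h_def by (rule integral_add) (rule integrable_h)+
  finally show ?thesis .
qed

text \<open>Coercivity gives \<open>h 0 \<le> h u\<close> outside \<open>{-R..R}\<close>, so a
  minimum on this compact interval is global.\<close>

lemma h_attains_minimum: "\<exists>z. \<forall>u. h z \<le> h u"
proof -
  define R where "R = 2 * h 0 / N"
  have R: "R \<ge> 0" using N_pos h_nonneg by (simp add: R_def)
  have "\<exists>z\<in>{-R..R}. \<forall>u\<in>{-R..R}. h z \<le> h u"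
    using R by (intro continuous_attains_inf continuous_h) auto
  then obtain z where z: "\<And>u. u \<in> {-R..R} \<Longrightarrow> h z \<le> h u" by blast
  have "h z \<le> h u" for u
  proof (cases "u \<in> {-R..R}")
    case False
    then have "R \<le> \<bar>u\<bar>" by auto
    then have "2 * h 0 \<le> \<bar>u\<bar> * N" using N_pos by (simp add: R_def divide_simps)
    then have "h 0 \<le> h u" using h_coercive[of u] by simp
    then show ?thesis using z[of 0] R by simp
  qed (rule z)
  then show ?thesis by blast
qed

text \<open>If two slopes were optimal, \<open>h\<close> would be affine between them, so the residual at the middle
  slope has no zero inside the interval and all three residuals share one sign; the two optimal
  values then differ by a multiple of the integral of \<open>\<phi>\<close>, which has a constant sign as well.\<close>

lemma h_minimum_unique:
  assumes u: "\<And>w. h u \<le> h w" and v: "\<And>w. h v \<le> h w"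
  shows "u = v"
proof -
  define m where "m = (u + v) / 2"
  let ?A = "\<lambda>t. Y t - u * \<phi> t" and ?B = "\<lambda>t. Y t - v * \<phi> t" and ?C = "\<lambda>t. Y t - m * \<phi> t"
  \<comment> \<open>The defect in the triangle inequality at the middle slope. It is nonnegative,
    and optimality of \<open>u\<close> and \<open>v\<close> makes its integral at most 0, so it
    vanishes pointwise by continuity.\<close>
  let ?E = "\<lambda>t. \<bar>?A t\<bar> + \<bar>?B t\<bar> - 2 * \<bar>?C t\<bar>"
  have AB: "?A t + ?B t = 2 * ?C t" for t
    by (simp add: m_def field_simps)
  have Enonneg: "?E t \<ge> 0" for t
    using AB[of t] by linarith
  have "integral {a..b} ?E = (h u + h v) - 2 * h m"
    unfolding h_def
    by (subst integral_diff integral_add;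
        (auto intro!: integrable_continuous_real continuous_intros cont_Y cont_\<phi>)?)+
  also have "\<dots> \<le> 0" using u[of m] v[of m] by simp
  finally have "integral {a..b} ?E \<le> 0" .
  moreover have cE: "continuous_on {a..b} ?E"
    by (intro continuous_intros cont_Y cont_\<phi>)
  then have "integral {a..b} ?E \<ge> 0"
    using Enonneg by (intro integral_nonneg integrable_continuous_real) auto
  ultimately have "integral {a..b} ?E = 0" by simp
  then have E0: "?E t = 0" if "t \<in> {a..b}" for t
    using integral_eq_0_iff[OF cE ab] Enonneg that by auto
  show "u = v"
  proof (rule ccontr)
    assume uv: "u \<noteq> v"
    have sub: "{a<..<b} \<subseteq> {a..b}" by auto
    have C_nz: "?C t \<noteq> 0" if t: "t \<in> {a<..<b}" for t
    proof
      assume "?C t = 0"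
      then have "?A t = 0" "?B t = 0" using E0[of t] t by (simp_all only: greaterThanLessThan_iff atLeastAtMost_iff) linarith+
      then have "(u - v) * \<phi> t = 0" by (simp add: algebra_simps)
      then show False using uv nonzero[OF t] by simp
    qed
    have "continuous_on {a<..<b} ?C" "continuous_on {a<..<b} \<phi>"
      by (rule continuous_on_subset[OF _ sub], intro continuous_intros cont_Y cont_\<phi>)+
    then have sgnC: "(\<forall>t\<in>{a<..<b}. ?C t > 0) \<or> (\<forall>t\<in>{a<..<b}. ?C t < 0)"
      and sgn\<phi>: "(\<forall>t\<in>{a<..<b}. \<phi> t > 0) \<or> (\<forall>t\<in>{a<..<b}. \<phi> t < 0)"
      using C_nz nonzero by (intro continuous_nonzero_constant_sign; auto)+
    \<comment> \<open>Equality in the triangle inequality: both summands carry the sign of their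
      sum. The explicit factors 1 and -1 are the candidates for \<open>\<sigma>\<close>
      below.\<close>
    have same_sign: "(c > 0 \<longrightarrow> \<bar>x\<bar> = 1 * x \<and> \<bar>y\<bar> = 1 * y) \<and> (c < 0 \<longrightarrow> \<bar>x\<bar> = -1 * x \<and> \<bar>y\<bar> = -1 * y)"
      if "x + y = 2 * c" "\<bar>x\<bar> + \<bar>y\<bar> - 2 * \<bar>c\<bar> = 0" for x y c :: real
      using that by (auto simp: abs_if split: if_splits)
    obtain \<sigma> :: real where \<sigma>: "\<sigma> \<noteq> 0"
      and A: "\<And>t. t \<in> {a<..<b} \<Longrightarrow> \<bar>?A t\<bar> = \<sigma> * ?A t"
      and B: "\<And>t. t \<in> {a<..<b} \<Longrightarrow> \<bar>?B t\<bar> = \<sigma> * ?B t"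
    proof (cases "\<forall>t\<in>{a<..<b}. ?C t > 0")
      case True
      have "\<bar>?A t\<bar> = 1 * ?A t \<and> \<bar>?B t\<bar> = 1 * ?B t" if t: "t \<in> {a<..<b}" for t
      proof -
        have "?C t > 0" "?E t = 0" using True t E0[of t] by auto
        then show ?thesis using same_sign[OF AB[of t]] by blast
      qed
      then show ?thesis using that[of 1] by auto
    next
      case False
      then have neg: "\<forall>t\<in>{a<..<b}. ?C t < 0" using sgnC by blast
      have "\<bar>?A t\<bar> = -1 * ?A t \<and> \<bar>?B t\<bar> = -1 * ?B t" if t: "t \<in> {a<..<b}" for t
      proof -
        have "?C t < 0" "?E t = 0" using neg t E0[of t] by auto
        then show ?thesis using same_sign[OF AB[of t]] by blast
      qed
      then show ?thesis using that[of "-1"] by auto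
    qed
    obtain \<tau> :: real where \<tau>: "\<tau> \<noteq> 0" and \<phi>: "\<And>t. t \<in> {a<..<b} \<Longrightarrow> \<phi> t = \<tau> * \<bar>\<phi> t\<bar>"
    proof (cases "\<forall>t\<in>{a<..<b}. \<phi> t > 0")
      case True
      then show ?thesis by (intro that[of 1]) (simp_all add: abs_of_pos)
    next
      case False
      then have "\<forall>t\<in>{a<..<b}. \<phi> t < 0" using sgn\<phi> by blast
      then show ?thesis by (intro that[of "-1"]) (simp_all add: abs_of_neg)
    qed
    have "0 = h u - h v" using u[of v] v[of u] by simp
    also have "\<dots> = integral {a..b} (\<lambda>t. \<bar>?A t\<bar> - \<bar>?B t\<bar>)"
      unfolding h_def by (rule integral_diff[symmetric]) (rule integrable_h)+
    \<comment> \<open>The signs are known only in the open interval, so the two endpoints are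
      discarded as a negligible set.\<close>
    also have "\<dots> = integral {a..b} (\<lambda>t. \<sigma> * (v - u) * \<tau> * \<bar>\<phi> t\<bar>)"
    proof (rule integral_spike[where S = "{a, b}"])
      fix t assume "t \<in> {a..b} - {a, b}"
      then have t: "t \<in> {a<..<b}" by auto
      have "\<sigma> * (v - u) * \<tau> * \<bar>\<phi> t\<bar> = \<sigma> * (v - u) * \<phi> t" using \<phi>[OF t] by simp
      also have "\<dots> = \<bar>?A t\<bar> - \<bar>?B t\<bar>" unfolding A[OF t] B[OF t] by (simp add: algebra_simps)
      finally show "\<sigma> * (v - u) * \<tau> * \<bar>\<phi> t\<bar> = \<bar>?A t\<bar> - \<bar>?B t\<bar>" .
    qed simp
    also have "\<dots> = \<sigma> * (v - u) * \<tau> * N" by (simp add: N_def)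
    finally show False using \<sigma> \<tau> uv N_pos by simp
  qed
qed

lemma h_strict_minimum: "\<exists>z. \<forall>u. u \<noteq> z \<longrightarrow> h z < h u"
proof -
  obtain z where z: "\<And>u. h z \<le> h u" using h_attains_minimum by blast
  have "h z < h u" if "u \<noteq> z" for u
    using z h_minimum_unique[of u z] that by (metis order_le_less)
  then show ?thesis by blast
qed

end

section \<open>The criterion near and far from the true parameter\<close>

text \<open>The bound saturates because \<open>exp x - 1\<close> stays bounded for negative
  \<open>x\<close>, where no linear lower bound can hold globally. It serves to bound the estimation
  error for arbitrary real \<open>\<theta>\<close>.\<close>

lemma abs_exp_minus_one_ge:
  fixes x :: real
  shows "\<bar>x\<bar> / (1 + \<bar>x\<bar>) \<le> \<bar>exp x - 1\<bar>"
proof (cases "x \<ge> 0")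
  case True
  have "x / (1 + x) \<le> x" using True by (simp add: divide_le_eq algebra_simps)
  also have "\<dots> \<le> exp x - 1" using exp_ge_add_one_self[of x] by linarith
  finally show ?thesis using True by simp
next
  case False
  then have "exp x * (1 - x) \<le> exp x * exp (- x)"
    using exp_ge_add_one_self[of "- x"] by (intro mult_left_mono) auto
  also have "\<dots> = 1" by (simp flip: exp_add)
  finally have "exp x \<le> 1 / (1 - x)" using False by (simp add: le_divide_eq)
  also have "\<dots> = 1 - \<bar>x\<bar> / (1 + \<bar>x\<bar>)" using False by (simp add: field_simps)
  finally show ?thesis by linarith
qed

lemma abs_exp_minus_linear_le:
  fixes x :: real
  assumes "\<bar>x\<bar> \<le> 1"
  shows "\<bar>exp x - 1 - x\<bar> \<le> x\<^sup>2"
proof -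
  have "exp x \<le> 1 + x + x\<^sup>2"
  proof (cases "x \<ge> 0")
    case True
    then show ?thesis using assms by (intro exp_bound) auto
  next
    case False
    have "exp x * (1 - x) \<le> exp x * exp (- x)"
      using exp_ge_add_one_self[of "- x"] by (intro mult_left_mono) auto
    also have "\<dots> = 1" by (simp flip: exp_add)
    \<comment> \<open>The factorisation of \<open>1 - x ^ 3\<close> allows cancelling the positive
      factor \<open>1 - x\<close> in the end.\<close>
    also have "1 \<le> 1 - x ^ 3" using False by (simp add: power3_eq_cube mult_nonneg_nonpos)
    also have "\<dots> = (1 + x + x\<^sup>2) * (1 - x)"
      by (simp add: algebra_simps power2_eq_square power3_eq_cube)
    finally show ?thesis using False by simp
  qed
  then show ?thesis using exp_ge_add_one_self[of x] by linarith
qed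

lemma x_det_diff: "x_det x0 \<theta> t - x_det x0 \<theta>0 t = x0 * exp (\<theta>0 * t) * (exp ((\<theta> - \<theta>0) * t) - 1)"
  by (simp add: x_det_def algebra_simps flip: exp_add)

text \<open>The criterion \<open>S1\<close> along the path \<open>X\<^sub>t = x\<^sub>t(\<theta>0) + \<epsilon> Y\<^sub>t\<close>.\<close>

definition perturbed_S1 :: "real \<Rightarrow> real \<Rightarrow> (real \<Rightarrow> real) \<Rightarrow> real \<Rightarrow> real \<Rightarrow> real" where
  "perturbed_S1 x0 \<theta>0 Y \<epsilon> \<theta> = integral {0..1} (\<lambda>t. \<bar>x_det x0 \<theta>0 t + \<epsilon> * Y t - x_det x0 \<theta> t\<bar>)"

lemma continuous_on_x_det [continuous_intros]: "continuous_on S (x_det x0 \<theta>)"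
  unfolding x_det_def by (intro continuous_intros)

lemma perturbed_S1_nonneg: "perturbed_S1 x0 \<theta>0 Y \<epsilon> \<theta> \<ge> 0"
  unfolding perturbed_S1_def
  \<comment> \<open>For a nonintegrable integrand \<open>integral\<close> takes the default value
    0.\<close>
  by (cases "(\<lambda>t. \<bar>x_det x0 \<theta>0 t + \<epsilon> * Y t - x_det x0 \<theta> t\<bar>) integrable_on {0..1}")
    (auto intro: integral_nonneg simp: not_integrable_integral)

locale tangent_line =
  fixes x0 \<theta>0 :: real and Y :: "real \<Rightarrow> real"
  assumes x0: "x0 \<noteq> 0" and cont: "continuous_on {0..1} Y"

text \<open>The direction is the derivative of \<open>x_det x0 \<theta> t\<close> in
  \<open>\<theta>\<close> at \<open>\<theta>0\<close>; on the unit interval it vanishes only at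
  \<open>t = 0\<close>.\<close>

sublocale tangent_line \<subseteq> L1_line 0 1 Y "\<lambda>t. t * x0 * exp (\<theta>0 * t)"
  using x0 cont by unfold_locales (auto intro!: continuous_intros)

context tangent_line
begin

abbreviation "S \<equiv> perturbed_S1 x0 \<theta>0 Y"

lemma perturbed_S1_at_truth: "\<epsilon> \<ge> 0 \<Longrightarrow> S \<epsilon> \<theta>0 = \<epsilon> * h 0"
  by (simp add: perturbed_S1_def h_def abs_mult)

text \<open>The noiseless curves for \<open>\<theta>\<close> and \<open>\<theta>0\<close> differ in
  L1 norm at least by the left-hand side, and the noise changes the criterion by at most
  \<open>\<epsilon> * h 0\<close>.\<close>

lemma identifiability:
  assumes "\<epsilon> \<ge> 0"
  shows "N * (\<bar>\<theta> - \<theta>0\<bar> / (1 + \<bar>\<theta> - \<theta>0\<bar>)) \<le> S \<epsilon> \<theta> + \<epsilon> * h 0"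
proof -
  let ?v = "\<theta> - \<theta>0"
  have "N * (\<bar>?v\<bar> / (1 + \<bar>?v\<bar>))
      = integral {0..1} (\<lambda>t. \<bar>t * x0 * exp (\<theta>0 * t)\<bar> * (\<bar>?v\<bar> / (1 + \<bar>?v\<bar>)))"
    by (simp only: N_def integral_mult_left)
  also have "\<dots> \<le> integral {0..1}
      (\<lambda>t. \<bar>x_det x0 \<theta>0 t + \<epsilon> * Y t - x_det x0 \<theta> t\<bar> + \<epsilon> * \<bar>Y t - 0 * (t * x0 * exp (\<theta>0 * t))\<bar>)"
  proof (rule integral_le)
    fix t :: real assume t: "t \<in> {0..1}"
    \<comment> \<open>Enlarging the denominator separates \<open>t\<close> from
      \<open>\<theta>\<close>, so that the integral becomes a multiple of \<open>N\<close>.\<close>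
    have "t * (\<bar>?v\<bar> / (1 + \<bar>?v\<bar>)) \<le> \<bar>?v * t\<bar> / (1 + \<bar>?v * t\<bar>)"
    proof -
      have "\<bar>?v * t\<bar> \<le> \<bar>?v\<bar>" using t by (simp add: abs_mult mult_left_le)
      then have "\<bar>?v * t\<bar> / (1 + \<bar>?v\<bar>) \<le> \<bar>?v * t\<bar> / (1 + \<bar>?v * t\<bar>)"
        by (intro divide_left_mono) (auto intro: mult_pos_pos add_pos_nonneg)
      then show ?thesis using t by (simp add: abs_mult mult.commute)
    qed
    also have "\<dots> \<le> \<bar>exp (?v * t) - 1\<bar>" by (rule abs_exp_minus_one_ge)
    finally have "\<bar>x0 * exp (\<theta>0 * t)\<bar> * (t * (\<bar>?v\<bar> / (1 + \<bar>?v\<bar>))) \<le> \<bar>x_det x0 \<theta> t - x_det x0 \<theta>0 t\<bar>"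
      unfolding x_det_diff abs_mult[of "x0 * _"] by (rule mult_left_mono) simp
    moreover have "\<bar>x_det x0 \<theta> t - x_det x0 \<theta>0 t\<bar>
        \<le> \<bar>x_det x0 \<theta>0 t + \<epsilon> * Y t - x_det x0 \<theta> t\<bar> + \<bar>\<epsilon> * Y t\<bar>"
      by linarith
    ultimately show "\<bar>t * x0 * exp (\<theta>0 * t)\<bar> * (\<bar>?v\<bar> / (1 + \<bar>?v\<bar>))
        \<le> \<bar>x_det x0 \<theta>0 t + \<epsilon> * Y t - x_det x0 \<theta> t\<bar> + \<epsilon> * \<bar>Y t - 0 * (t * x0 * exp (\<theta>0 * t))\<bar>"
      using t assms by (simp add: abs_mult mult_ac)
  qed (intro integrable_continuous_real continuous_intros cont)+
  also have "\<dots> = S \<epsilon> \<theta> + \<epsilon> * h 0"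
    unfolding perturbed_S1_def h_def integral_mult_right[symmetric]
    by (intro integral_add integrable_continuous_real continuous_intros cont)
  finally show ?thesis .
qed

text \<open>Second-order Taylor remainder of the exponential: replacing the curve by its tangent
  costs order \<open>(\<epsilon> * u)\<^sup>2\<close>, which is negligible against
  \<open>\<epsilon> * h u\<close> for bounded \<open>u\<close>.\<close>

lemma linearization:
  assumes \<epsilon>: "\<epsilon> > 0" and u: "\<bar>\<epsilon> * u\<bar> \<le> 1"
  shows "\<bar>S \<epsilon> (\<theta>0 + \<epsilon> * u) - \<epsilon> * h u\<bar> \<le> \<bar>x0\<bar> * exp \<bar>\<theta>0\<bar> * (\<epsilon> * u)\<^sup>2"
proof -
  let ?f = "\<lambda>t. \<bar>x_det x0 \<theta>0 t + \<epsilon> * Y t - x_det x0 (\<theta>0 + \<epsilon> * u) t\<bar>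
      - \<epsilon> * \<bar>Y t - u * (t * x0 * exp (\<theta>0 * t))\<bar>"
  have "S \<epsilon> (\<theta>0 + \<epsilon> * u) - \<epsilon> * h u = integral {0..1} ?f"
    unfolding perturbed_S1_def h_def integral_mult_right[symmetric]
    by (intro integral_diff[symmetric] integrable_continuous_real continuous_intros cont)
  also have "norm \<dots> \<le> \<bar>x0\<bar> * exp \<bar>\<theta>0\<bar> * (\<epsilon> * u)\<^sup>2 * (1 - 0)"
  proof (rule integral_bound)
    fix t :: real assume t: "t \<in> {0..1}"
    let ?p = "x0 * exp (\<theta>0 * t)" and ?w = "\<epsilon> * u * t"
    have w: "\<bar>?w\<bar> \<le> \<bar>\<epsilon> * u\<bar>" using t by (simp add: abs_mult mult_left_le)
    have eq: "x_det x0 \<theta>0 t + \<epsilon> * Y t - x_det x0 (\<theta>0 + \<epsilon> * u) t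
        = \<epsilon> * (Y t - u * (t * x0 * exp (\<theta>0 * t))) - ?p * (exp ?w - 1 - ?w)"
      using x_det_diff[of x0 "\<theta>0 + \<epsilon> * u" t \<theta>0] by (simp add: algebra_simps)
    have "\<epsilon> * \<bar>Y t - u * (t * x0 * exp (\<theta>0 * t))\<bar> = \<bar>\<epsilon> * (Y t - u * (t * x0 * exp (\<theta>0 * t)))\<bar>"
      using \<epsilon> by (simp add: abs_mult)
    then have "\<bar>?f t\<bar> \<le> \<bar>?p * (exp ?w - 1 - ?w)\<bar>"
      unfolding eq by linarith
    also have "\<dots> = \<bar>x0\<bar> * exp (\<theta>0 * t) * \<bar>exp ?w - 1 - ?w\<bar>" by (simp add: abs_mult)
    also have "\<dots> \<le> \<bar>x0\<bar> * exp \<bar>\<theta>0\<bar> * (\<epsilon> * u)\<^sup>2"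
    proof (intro mult_mono)
      have "\<theta>0 * t \<le> \<bar>\<theta>0 * t\<bar>" by simp
      also have "\<dots> \<le> \<bar>\<theta>0\<bar>" using t by (simp add: abs_mult mult_left_le)
      finally show "exp (\<theta>0 * t) \<le> exp \<bar>\<theta>0\<bar>" by simp
      have "\<bar>exp ?w - 1 - ?w\<bar> \<le> ?w\<^sup>2" using w u by (intro abs_exp_minus_linear_le) linarith
      also have "\<dots> \<le> (\<epsilon> * u)\<^sup>2" using w by (simp add: abs_le_square_iff)
      finally show "\<bar>exp ?w - 1 - ?w\<bar> \<le> (\<epsilon> * u)\<^sup>2" .
    qed auto
    finally show "norm (?f t) \<le> \<bar>x0\<bar> * exp \<bar>\<theta>0\<bar> * (\<epsilon> * u)\<^sup>2" by simp
  qed (intro continuous_intros cont | simp)+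
  finally show ?thesis by simp
qed

text \<open>Identifiability first confines the rescaled error to \<open>{-R..R}\<close>. Comparison
  with the competitor \<open>\<theta>0 + \<epsilon> * z\<close>, admissible because
  \<open>\<theta>0\<close> is interior, then gives \<open>h u < h z + \<eta>\<close>, and separation
  of the minimum concludes.\<close>

lemma rescaled_minimizer_close:
  assumes interior: "\<theta>0 \<in> interior \<Theta>" and z: "\<And>u. u \<noteq> z \<Longrightarrow> h z < h u" and \<delta>: "\<delta> > 0"
  shows "\<exists>\<epsilon>0>0. \<forall>\<epsilon> \<theta>. 0 < \<epsilon> \<and> \<epsilon> < \<epsilon>0 \<and> \<theta> \<in> \<Theta> \<and> (\<forall>\<theta>'\<in>\<Theta>. S \<epsilon> \<theta> \<le> S \<epsilon> \<theta>')
    \<longrightarrow> \<bar>(\<theta> - \<theta>0) / \<epsilon> - z\<bar> < \<delta>"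
proof -
  obtain \<eta> where \<eta>: "\<eta> > 0" and sep: "\<And>u. \<delta> \<le> \<bar>u - z\<bar> \<Longrightarrow> h z + \<eta> \<le> h u"
    using convex_strict_minimum_separated[OF convex_h z \<delta>] by blast
  obtain r where r: "r > 0" "ball \<theta>0 r \<subseteq> \<Theta>"
    using interior by (auto simp: mem_interior)
  \<comment> \<open>\<open>h 0\<close> may be zero; adding 1 makes \<open>K\<close> a valid
    denominator.\<close>
  define K where "K = h 0 + 1"
  have K: "K > 0" "h 0 \<le> K" using h_nonneg[of 0] by (auto simp: K_def)
  define R where "R = Max {1, 4 * K / N, \<bar>z\<bar>}"
  have R: "R \<ge> 1" "4 * K / N \<le> R" "\<bar>z\<bar> \<le> R" by (auto simp: R_def)
  define C where "C = \<bar>x0\<bar> * exp \<bar>\<theta>0\<bar>"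
  have C: "C > 0" using x0 by (simp add: C_def)
  \<comment> \<open>In this order, the thresholds absorb the error term in the identifiability
    bound, permit the linearization, place the competitor in \<open>\<Theta>\<close>, and keep the
    two linearization errors together below \<open>\<epsilon> * \<eta>\<close>.\<close>
  define \<epsilon>0 where "\<epsilon>0 = Min {N / (4 * K), 1 / R, r / R, \<eta> / (2 * C * R\<^sup>2)}"
  have \<epsilon>0: "\<epsilon>0 > 0" using N_pos K R r \<eta> C by (simp add: \<epsilon>0_def)
  show ?thesis
  proof (intro exI[of _ \<epsilon>0] conjI \<epsilon>0 allI impI)
    fix \<epsilon> \<theta>
    assume *: "0 < \<epsilon> \<and> \<epsilon> < \<epsilon>0 \<and> \<theta> \<in> \<Theta> \<and> (\<forall>\<theta>'\<in>\<Theta>. S \<epsilon> \<theta> \<le> S \<epsilon> \<theta>')"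
    then have \<epsilon>: "\<epsilon> > 0" and opt: "\<And>\<theta>'. \<theta>' \<in> \<Theta> \<Longrightarrow> S \<epsilon> \<theta> \<le> S \<epsilon> \<theta>'" by auto
    have "\<epsilon> < N / (4 * K)" "\<epsilon> < 1 / R" "\<epsilon> < r / R" "\<epsilon> < \<eta> / (2 * C * R\<^sup>2)"
      using * by (auto simp: \<epsilon>0_def)
    then have small: "4 * \<epsilon> * K < N" "\<epsilon> * R < 1" "\<epsilon> * R < r" "2 * \<epsilon> * C * R\<^sup>2 < \<eta>"
      using K R C by (auto simp: less_divide_eq mult_ac)
    define u where "u = (\<theta> - \<theta>0) / \<epsilon>"
    have \<theta>: "\<theta> = \<theta>0 + \<epsilon> * u" using \<epsilon> by (simp add: u_def)
    have u: "\<bar>u\<bar> \<le> R"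
    proof -
      let ?v = "\<bar>\<theta> - \<theta>0\<bar>"
      have "\<theta>0 \<in> \<Theta>" using interior interior_subset by blast
      then have "S \<epsilon> \<theta> \<le> \<epsilon> * h 0" using opt perturbed_S1_at_truth[of \<epsilon>] \<epsilon> by force
      then have "N * (?v / (1 + ?v)) \<le> 2 * (\<epsilon> * h 0)"
        using identifiability[of \<epsilon> \<theta>] \<epsilon> by linarith
      also have "\<dots> \<le> 2 * \<epsilon> * K" using K \<epsilon> by simp
      finally have "N * ?v \<le> 2 * \<epsilon> * K * (1 + ?v)"
        by (simp add: divide_le_eq add_pos_nonneg split: if_splits)
      \<comment> \<open>This moves half of \<open>N * ?v\<close> to the left-hand side, which turns
        the saturated bound into a linear one.\<close>
      moreover have "4 * \<epsilon> * K * ?v \<le> N * ?v"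
        using small by (intro mult_right_mono) auto
      ultimately have "N * ?v \<le> 4 * \<epsilon> * K" by (simp add: algebra_simps)
      then have "?v / \<epsilon> \<le> 4 * K / N" using N_pos \<epsilon> by (simp add: field_simps)
      then show ?thesis using R \<epsilon> by (simp add: u_def)
    qed
    have lin: "\<bar>S \<epsilon> (\<theta>0 + \<epsilon> * w) - \<epsilon> * h w\<bar> \<le> \<epsilon> * (\<epsilon> * C * R\<^sup>2)" if w: "\<bar>w\<bar> \<le> R" for w
    proof -
      have "\<bar>\<epsilon> * w\<bar> \<le> \<epsilon> * R" using w \<epsilon> by (simp add: abs_mult)
      then have le1: "\<bar>\<epsilon> * w\<bar> \<le> 1" and sq: "(\<epsilon> * w)\<^sup>2 \<le> (\<epsilon> * R)\<^sup>2"
        using small power_mono[of "\<bar>\<epsilon> * w\<bar>" "\<epsilon> * R" 2] by auto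
      have "\<bar>S \<epsilon> (\<theta>0 + \<epsilon> * w) - \<epsilon> * h w\<bar> \<le> C * (\<epsilon> * w)\<^sup>2"
        unfolding C_def by (rule linearization[OF \<epsilon> le1])
      also have "\<dots> \<le> C * (\<epsilon> * R)\<^sup>2" using C sq by simp
      finally show ?thesis by (simp add: power2_eq_square mult_ac)
    qed
    have "\<bar>\<epsilon> * z\<bar> < r"
    proof -
      have "\<bar>\<epsilon> * z\<bar> \<le> \<epsilon> * R" using R \<epsilon> by (simp add: abs_mult)
      then show ?thesis using small by simp
    qed
    then have "\<theta>0 + \<epsilon> * z \<in> \<Theta>" using r(2) by (auto simp: dist_real_def)
    then have "S \<epsilon> \<theta> \<le> S \<epsilon> (\<theta>0 + \<epsilon> * z)" by (rule opt)
    then have "\<epsilon> * h u \<le> \<epsilon> * h z + 2 * (\<epsilon> * (\<epsilon> * C * R\<^sup>2))"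
      using lin[OF u] lin[OF R(3)] unfolding \<theta> by linarith
    also have "\<dots> = \<epsilon> * (h z + 2 * \<epsilon> * C * R\<^sup>2)" by (simp add: algebra_simps)
    finally have "h u \<le> h z + 2 * \<epsilon> * C * R\<^sup>2" using \<epsilon> by simp
    then have "h u < h z + \<eta>" using small by linarith
    then show "\<bar>(\<theta> - \<theta>0) / \<epsilon> - z\<bar> < \<delta>"
      using sep[of u] by (force simp: u_def)
  qed
qed

end

section \<open>Almost sure convergence of the rescaled estimators along sequences\<close>

lemma zeta_objective_eq:
  assumes "tangent_line x0 (\<lambda>t. Y_process \<theta>0 G t \<omega>)"
  shows "zeta_objective x0 \<theta>0 G \<omega>
    = L1_line.h 0 1 (\<lambda>t. Y_process \<theta>0 G t \<omega>) (\<lambda>t. t * x0 * exp (\<theta>0 * t))"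
proof -
  interpret tangent_line x0 \<theta>0 "\<lambda>t. Y_process \<theta>0 G t \<omega>" by fact
  show ?thesis unfolding zeta_objective_def h_def by (simp add: mult.assoc)
qed

text \<open>\<open>arg_min\<close> is a Hilbert choice; the existence of a strict minimiser pins the
  chosen value down.\<close>

lemma zeta_strict_minimum:
  assumes x0: "x0 \<noteq> 0" and cont: "continuous_on {0..1} (\<lambda>t. G t \<omega>)" and u: "u \<noteq> zeta x0 \<theta>0 G \<omega>"
  shows "zeta_objective x0 \<theta>0 G \<omega> (zeta x0 \<theta>0 G \<omega>) < zeta_objective x0 \<theta>0 G \<omega> u"
proof -
  let ?o = "zeta_objective x0 \<theta>0 G \<omega>"
  have T: "tangent_line x0 (\<lambda>t. Y_process \<theta>0 G t \<omega>)"
    using x0 continuous_on_Y_process[of G \<omega>, OF cont] by unfold_locales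
  interpret tangent_line x0 \<theta>0 "\<lambda>t. Y_process \<theta>0 G t \<omega>" by (rule T)
  obtain z where z: "\<And>u. u \<noteq> z \<Longrightarrow> ?o z < ?o u"
    using h_strict_minimum unfolding zeta_objective_eq[OF T] by blast
  have "is_arg_min ?o (\<lambda>_. True) z"
    unfolding is_arg_min_def using z by (metis order_less_asym less_irrefl)
  then have "is_arg_min ?o (\<lambda>_. True) (zeta x0 \<theta>0 G \<omega>)"
    unfolding zeta_def arg_min_def by (rule someI)
  then have "zeta x0 \<theta>0 G \<omega> = z"
    using z unfolding is_arg_min_def by blast
  then show ?thesis using z u by simp
qed

text \<open>The exceptional null sets depend on the noise level, and only countably many can be
  collected into one; hence sequences \<open>e n\<close>. Outside their union the argument is
  deterministic.\<close>

lemma estimator_rescaled_tendsto_zeta: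
  fixes e :: "nat \<Rightarrow> real"
  assumes x0: "x0 \<noteq> 0" and interior: "\<theta>0 \<in> interior \<Theta>"
    and G: "AE \<omega> in M. continuous_on {0..1} (\<lambda>t. G t \<omega>)"
    and e: "\<And>n. e n > 0" "e \<longlonglongrightarrow> 0"
    and X: "\<And>n. solves_equation M G x0 \<theta>0 (e n) (X n)"
    and \<theta>s: "\<And>n. minimum_L1_norm_estimator M \<Theta> x0 (X n) (\<theta>s n)"
  shows "AE \<omega> in M. (\<lambda>n. (\<theta>s n \<omega> - \<theta>0) / e n) \<longlonglongrightarrow> zeta x0 \<theta>0 G \<omega>"
proof -
  have "AE \<omega> in M. \<forall>n. (\<lambda>s. X n s \<omega>) integrable_on {0..1} \<and> X n 0 \<omega> = x0 \<and>
      (\<forall>t\<in>{0..1}. X n t \<omega> = x0 + \<theta>0 * integral {0..t} (\<lambda>s. X n s \<omega>) + e n * G t \<omega>)"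
    using X unfolding solves_equation_def by (simp add: AE_all_countable)
  moreover have "AE \<omega> in M. \<forall>n. S1 x0 (X n) \<omega> (\<theta>s n \<omega>) = (INF \<theta>\<in>\<Theta>. S1 x0 (X n) \<omega> \<theta>)"
    using \<theta>s unfolding minimum_L1_norm_estimator_def by (simp add: AE_all_countable)
  ultimately show ?thesis
    using G AE_space
  proof eventually_elim
    case (elim \<omega>)
    let ?Y = "\<lambda>t. Y_process \<theta>0 G t \<omega>"
    let ?z = "zeta x0 \<theta>0 G \<omega>"
    have contG: "continuous_on {0..1} (\<lambda>t. G t \<omega>)" using elim by simp
    have T: "tangent_line x0 ?Y"
      using x0 continuous_on_Y_process[of G \<omega>, OF contG] by unfold_locales
    interpret tangent_line x0 \<theta>0 ?Y by (rule T)
    have S1: "S1 x0 (X n) \<omega> \<theta> = S (e n) \<theta>" for n \<theta>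
      unfolding S1_def perturbed_S1_def
    proof (rule Henstock_Kurzweil_Integration.integral_cong)
      fix t :: real assume t: "t \<in> {0..1}"
      have "X n t \<omega> = x_det x0 \<theta>0 t + e n * ?Y t"
        using elim by (intro solution_eq_Y_process[OF e(1), where x = "\<lambda>s. X n s \<omega>"] contG t) auto
      then show "\<bar>X n t \<omega> - x_det x0 \<theta> t\<bar> = \<bar>x_det x0 \<theta>0 t + e n * ?Y t - x_det x0 \<theta> t\<bar>" by simp
    qed
    have opt: "\<theta>s n \<omega> \<in> \<Theta> \<and> (\<forall>\<theta>'\<in>\<Theta>. S (e n) (\<theta>s n \<omega>) \<le> S (e n) \<theta>')" for n
    proof (intro conjI ballI)
      show "\<theta>s n \<omega> \<in> \<Theta>" using \<theta>s elim unfolding minimum_L1_norm_estimator_def by blast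
      fix \<theta>' assume "\<theta>' \<in> \<Theta>"
      have "S (e n) (\<theta>s n \<omega>) = (INF \<theta>\<in>\<Theta>. S (e n) \<theta>)" using elim by (simp add: S1)
      also have "\<dots> \<le> S (e n) \<theta>'"
        using \<open>\<theta>' \<in> \<Theta>\<close> perturbed_S1_nonneg by (intro cINF_lower bdd_belowI2)
      finally show "S (e n) (\<theta>s n \<omega>) \<le> S (e n) \<theta>'" .
    qed
    have min: "h ?z < h u" if "u \<noteq> ?z" for u
      using zeta_strict_minimum[of x0 G \<omega>, OF x0 contG that] unfolding zeta_objective_eq[OF T] .
    show ?case
    proof (rule tendstoI)
      fix \<delta> :: real assume "\<delta> > 0"
      then obtain \<epsilon>0 where \<epsilon>0: "\<epsilon>0 > 0" and close: "\<And>\<epsilon> \<theta>. 0 < \<epsilon> \<and> \<epsilon> < \<epsilon>0 \<and> \<theta> \<in> \<Theta> \<and>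
          (\<forall>\<theta>'\<in>\<Theta>. S \<epsilon> \<theta> \<le> S \<epsilon> \<theta>') \<Longrightarrow> \<bar>(\<theta> - \<theta>0) / \<epsilon> - ?z\<bar> < \<delta>"
        using rescaled_minimizer_close[OF interior min] by blast
      have "\<forall>\<^sub>F n in sequentially. e n < \<epsilon>0"
        using e(2) \<epsilon>0 by (rule order_tendstoD)
      then show "\<forall>\<^sub>F n in sequentially. dist ((\<theta>s n \<omega> - \<theta>0) / e n) ?z < \<delta>"
      proof eventually_elim
        case (elim n)
        then show ?case using close[of "e n" "\<theta>s n \<omega>"] opt[of n] e(1)[of n] by (simp add: dist_real_def)
      qed
    qed
  qed
qed

section \<open>Convergence in probability and measurability of the limit\<close>

lemma (in finite_measure) AE_tendsto_imp_measure_tendsto_0: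
  fixes V :: "nat \<Rightarrow> 'a \<Rightarrow> real"
  assumes [measurable]: "\<And>n. V n \<in> borel_measurable M" "Z \<in> borel_measurable M"
    and lim: "AE \<omega> in M. (\<lambda>n. V n \<omega>) \<longlonglongrightarrow> Z \<omega>" and \<delta>: "\<delta> > 0"
  shows "(\<lambda>n. measure M {\<omega> \<in> space M. \<bar>V n \<omega> - Z \<omega>\<bar> > \<delta>}) \<longlonglongrightarrow> 0"
proof -
  let ?A = "\<lambda>n. {\<omega> \<in> space M. \<bar>V n \<omega> - Z \<omega>\<bar> > \<delta>}"
  have "(\<lambda>n. integral\<^sup>L M (indicator (?A n) :: 'a \<Rightarrow> real)) \<longlonglongrightarrow> integral\<^sup>L M (\<lambda>_. 0)"
  proof (rule integral_dominated_convergence[where w = "\<lambda>_. 1"])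
    show "AE \<omega> in M. (\<lambda>n. indicator (?A n) \<omega> :: real) \<longlonglongrightarrow> 0"
      using lim
    proof eventually_elim
      case (elim \<omega>)
      have "\<forall>\<^sub>F n in sequentially. dist (V n \<omega>) (Z \<omega>) < \<delta>"
        using elim \<delta> by (rule tendstoD)
      then have "\<forall>\<^sub>F n in sequentially. indicator (?A n) \<omega> = (0 :: real)"
        by eventually_elim (auto simp: dist_real_def indicator_def)
      then show ?case by (rule tendsto_eventually)
    qed
  qed (auto simp: indicator_def)
  then show ?thesis by simp
qed

text \<open>The preimages of a set under \<open>f\<close> and \<open>g\<close> differ by a null set,
  which completeness makes measurable. This covers \<open>zeta\<close>, whose values on exceptional
  paths come from an arbitrary choice.\<close>

lemma (in complete_measure) measurable_AE_cong:
  assumes f: "f \<in> M \<rightarrow>\<^sub>M L" and ae: "AE x in M. f x = g x" and g: "\<And>x. x \<in> space M \<Longrightarrow> g x \<in> space L"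
  shows "g \<in> M \<rightarrow>\<^sub>M L"
proof (rule measurableI)
  fix A assume "A \<in> sets L"
  show "g -` A \<inter> space M \<in> sets M"
  proof (rule in_sets_AE)
    show "f -` A \<inter> space M \<in> sets M" using f \<open>A \<in> sets L\<close> by (rule measurable_sets)
    show "AE x in M. x \<in> f -` A \<inter> space M \<longleftrightarrow> x \<in> g -` A \<inter> space M"
      using ae by eventually_elim auto
  qed simp
qed (rule g)

theorem theorem4p1:
  fixes M :: "'a measure"
    and F :: "real \<Rightarrow> 'a measure"
    and G :: "real \<Rightarrow> 'a \<Rightarrow> real"
    and X :: "real \<Rightarrow> real \<Rightarrow> 'a \<Rightarrow> real"
    and \<theta>s :: "real \<Rightarrow> 'a \<Rightarrow> real"
    and \<Theta> :: "real set"
    and x0 \<theta>0 :: real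
  assumes "stochastic_basis M F"
    and "usual_conditions M F"
    and "centered_continuous_gaussian_process M G"
    and "adapted F G"
    and "x0 \<noteq> 0"
    and "\<theta>0 \<in> interior \<Theta>"
    and "\<And>\<epsilon>. \<epsilon> > 0 \<Longrightarrow> adapted F (X \<epsilon>)"
    and "\<And>\<epsilon>. \<epsilon> > 0 \<Longrightarrow> solves_equation M G x0 \<theta>0 \<epsilon> (X \<epsilon>)"
    and "\<And>\<epsilon>. \<epsilon> > 0 \<Longrightarrow> minimum_L1_norm_estimator M \<Theta> x0 (X \<epsilon>) (\<theta>s \<epsilon>)"
  shows "(AE \<omega> in M. \<exists>!u. is_arg_min (zeta_objective x0 \<theta>0 G \<omega>) (\<lambda>_. True) u) \<and>
    zeta x0 \<theta>0 G \<in> borel_measurable M \<and>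
    (\<exists>Z \<in> borel_measurable M.
       distr M borel Z = distr M borel (zeta x0 \<theta>0 G) \<and>
       converges_in_probability_at_0 M (\<lambda>\<epsilon> \<omega>. (\<theta>s \<epsilon> \<omega> - \<theta>0) / \<epsilon>) Z)"
proof (intro conjI)
  let ?\<zeta> = "zeta x0 \<theta>0 G" and ?V = "\<lambda>\<epsilon> \<omega>. (\<theta>s \<epsilon> \<omega> - \<theta>0) / \<epsilon>"
  interpret prob_space M using assms(1) by (simp add: stochastic_basis_def)
  interpret complete_measure M using assms(2) by (simp add: usual_conditions_def)
  have G: "AE \<omega> in M. continuous_on {0..1} (\<lambda>t. G t \<omega>)"
    using assms(3) by (simp add: centered_continuous_gaussian_process_def)
  then show "AE \<omega> in M. \<exists>!u. is_arg_min (zeta_objective x0 \<theta>0 G \<omega>) (\<lambda>_. True) u"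
  proof eventually_elim
    case (elim \<omega>)
    note min = zeta_strict_minimum[of x0 G \<omega>, OF assms(5) elim, of _ \<theta>0]
    show ?case
      unfolding is_arg_min_def
      by (rule ex1I[of _ "?\<zeta> \<omega>"]; metis min order_less_asym)
  qed
  have V_meas [measurable]: "?V \<epsilon> \<in> borel_measurable M" if "\<epsilon> > 0" for \<epsilon>
  proof -
    have [measurable]: "\<theta>s \<epsilon> \<in> borel_measurable M"
      using assms(9)[OF that] unfolding minimum_L1_norm_estimator_def by blast
    show ?thesis by measurable
  qed
  have lim: "AE \<omega> in M. (\<lambda>n. ?V (e n) \<omega>) \<longlonglongrightarrow> ?\<zeta> \<omega>"
    if "\<And>n. e n > 0" "e \<longlonglongrightarrow> 0" for e :: "nat \<Rightarrow> real"
    using assms(5,6) G that assms(8,9)[OF that(1)] by (rule estimator_rescaled_tendsto_zeta)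
  \<comment> \<open>Any positive null sequence would do: it exhibits \<open>zeta\<close> as an
    almost sure limit of measurable functions.\<close>
  define e :: "nat \<Rightarrow> real" where "e n = inverse (real (Suc n))" for n
  have e: "e n > 0" "e \<longlonglongrightarrow> 0" for n
    using LIMSEQ_inverse_real_of_nat by (simp_all add: e_def[abs_def])
  show \<zeta>_meas: "?\<zeta> \<in> borel_measurable M"
  proof (rule measurable_AE_cong)
    show "(\<lambda>\<omega>. lim (\<lambda>n. ?V (e n) \<omega>)) \<in> borel_measurable M"
      by (intro borel_measurable_lim_metric V_meas e)
    show "AE \<omega> in M. lim (\<lambda>n. ?V (e n) \<omega>) = ?\<zeta> \<omega>"
      using lim[OF e] by eventually_elim (rule limI)
  qed simp
  show "\<exists>Z \<in> borel_measurable M. distr M borel Z = distr M borel ?\<zeta> \<and>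
      converges_in_probability_at_0 M ?V Z"
  proof (intro bexI conjI)
    show "converges_in_probability_at_0 M ?V ?\<zeta>"
      unfolding converges_in_probability_at_0_def
    \<comment> \<open>The one-sided limit at 0 is tested along positive null sequences; 1 is an
      arbitrary point to the right of 0.\<close>
    proof (intro allI impI tendsto_at_right_sequentially[of 0 1])
      fix \<delta> :: real and e :: "nat \<Rightarrow> real"
      assume "\<delta> > 0" and e: "\<And>n. 0 < e n" "e \<longlonglongrightarrow> 0"
      then show "(\<lambda>n. measure M {\<omega> \<in> space M. \<delta> < \<bar>?V (e n) \<omega> - ?\<zeta> \<omega>\<bar>}) \<longlonglongrightarrow> 0"
        by (intro AE_tendsto_imp_measure_tendsto_0 V_meas \<zeta>_meas lim)
    qed simp
  qed (simp_all add: \<zeta>_meas)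
qed

end
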